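(* Consider the 3-component Novikov system for functions $u,p,r$ of $(x,t)$, $$u_t+(upr)_x=0,\qquad v_t+3vp_xr+v_xpr+u^2p=0,\qquad w_t+3wpr_x+w_xpr-u^2r=0,$$ with $v=p-p_{xx}$, $w=r-r_{xx}$. This is a bi-Hamiltonian system, namely it may be written as $$\begin{pmatrix} u \\ v \\ w \end{pmatrix}_t=\mathcal J\begin{pmatrix}\delta H_2/\delta u\\ \delta H_2/\delta v\\ \delta H_2/\delta w\end{pmatrix}=\mathcal K\begin{pmatrix}\delta H_1/\delta u\\ \delta H_1/\delta v\\ \delta H_1/\delta w\end{pmatrix},$$ where $$\mathcal J=\begin{pmatrix}\tfrac12\partial&0&0\\ 0&0&1-\partial^2\\ 0&\partial^2-1&0\end{pmatrix},$$ $$\mathcal K=\begin{pmatrix}0&0&0\\ 0&\tfrac32v\partial^{-1}v&-u^2-\tfrac32v\partial^{-1}w\\ 0&u^2-\tfrac32w\partial^{-1}v&\tfrac32w\partial^{-1}w\end{pmatrix}-2\,\Omega(\partial^3-4\partial)^{-1}\Omega^{*},$$ $$\Omega=\left(\partial u,\ \tfrac12v\partial+\partial v,\ \tfrac12w\partial+\partial w\right)^T,$$ and $$H_1=\int pw\,dx,\qquad H_2=-\int\left[u^2pr+wpp_xr-wp^2r_x\right]dx .$$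
   Context: $\partial=\partial_x$; products such as $\partial u$ denote composition of $\partial$ with multiplication by $u$. $\Omega^{*}$ is the formal adjoint (row vector) of $\Omega$: $\Omega^*=(-u\partial,\,-\tfrac12\partial v-v\partial,\,-\tfrac12\partial w-w\partial)$. Functions $u,p,r$ (hence $v,w$) are smooth and rapidly decaying in $x$; $p=(1-\partial^2)^{-1}v$, $r=(1-\partial^2)^{-1}w$, so $H_1,H_2$ are functionals of $(u,v,w)$ and the variational derivatives are taken with respect to $u,v,w$. $\partial^{-1}$ and $(\partial^3-4\partial)^{-1}$ are formal inverses, with zero integration constants (for example $\partial^{-1}(f_x)=f$ and $(\partial^3-4\partial)^{-1}(f_{xxx}-4f_x)=f$ for decaying $f$). It is known from earlier work that $\mathcal J$ and $\mathcal K$ form a compatible pair of Hamiltonian operators. *)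

theory Defs
  imports "HOL-Analysis.Analysis" "HOL-Real_Asymp.Real_Asymp"
begin

type_synonym fn = "real \<Rightarrow> real"

definition smooth :: "fn \<Rightarrow> bool" where
  "smooth f \<longleftrightarrow> (\<forall>n x. (deriv ^^ n) f differentiable (at x))"

text \<open>``Smooth and rapidly decaying'' is read as: Schwartz function on the real line.\<close>

definition schwartz :: "fn \<Rightarrow> bool" where
  "schwartz f \<longleftrightarrow> smooth f \<and> (\<forall>k n. bounded (range (\<lambda>x. x ^ k * (deriv ^^ n) f x)))"


section \<open>Formal inverses of differential operators\<close>

text \<open>The value of the formal inverse of \<open>A\<close> at \<open>f\<close> is the smooth bounded solution \<open>g\<close>
  of \<open>A g = f\<close> that tends to \<open>0\<close> at minus infinity. The last requirement sets the
  integration constants to zero. For the three operators below such a \<open>g\<close> is unique, and it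
  exists for every Schwartz \<open>f\<close>. One cannot ask for decay at both ends: the entries of the
  operator matrix \<open>opK\<close> apply \<open>\<partial>\<^sup>-\<^sup>1\<close> to functions with nonzero total integral.\<close>

definition formal_inverse :: "(fn \<Rightarrow> fn) \<Rightarrow> fn \<Rightarrow> fn" where
  "formal_inverse A f =
     (THE g. smooth g \<and> bounded (range g) \<and> (g \<longlongrightarrow> 0) at_bot \<and> A g = f)"

abbreviation D :: "fn \<Rightarrow> fn" where
  "D \<equiv> deriv"

definition Helm :: "fn \<Rightarrow> fn" where  (* 1 - D^2 *)
  "Helm f = (\<lambda>x. f x - (D ^^ 2) f x)"

definition Cub :: "fn \<Rightarrow> fn" where  (* D^3 - 4 D *)
  "Cub f = (\<lambda>x. (D ^^ 3) f x - 4 * D f x)"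

abbreviation Dinv :: "fn \<Rightarrow> fn" where
  "Dinv \<equiv> formal_inverse D"

abbreviation Helm_inv :: "fn \<Rightarrow> fn" where
  "Helm_inv \<equiv> formal_inverse Helm"

abbreviation Cub_inv :: "fn \<Rightarrow> fn" where
  "Cub_inv \<equiv> formal_inverse Cub"

text \<open>Check of the convention: if \<open>f\<close> is a Schwartz function, then the formal inverse of
  \<open>A\<close> maps \<open>A f\<close> back to \<open>f\<close>.\<close>

lemma deriv0_const:
  fixes h :: fn
  assumes "\<And>x. (h has_real_derivative 0) (at x)"
  shows "\<exists>A. \<forall>x. h x = A"
  using assms DERIV_isconst_all[of h] by blast

lemma bounded_hyperbolic_zero:
  fixes h h1 :: fn
  assumes c: "c > 0" and bnd: "bounded (range h)"
    and d0: "\<And>x. (h has_real_derivative h1 x) (at x)"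
    and d1: "\<And>x. (h1 has_real_derivative c\<^sup>2 * h x) (at x)"
  shows "h x = 0"
proof -
  have "\<exists>A. \<forall>x. (h1 x + c * h x) * exp (- c * x) = A"
  proof -
    have "((\<lambda>x. (h1 x + c * h x) * exp (- c * x)) has_real_derivative 0) (at x)" for x
      by (auto intro!: derivative_eq_intros d0 d1 simp: algebra_simps power2_eq_square)
    then show ?thesis using deriv0_const by blast
  qed
  then obtain A where A: "\<And>x. (h1 x + c * h x) * exp (- c * x) = A" by blast
  have "\<exists>B. \<forall>x. (h1 x - c * h x) * exp (c * x) = B"
  proof -
    have "((\<lambda>x. (h1 x - c * h x) * exp (c * x)) has_real_derivative 0) (at x)" for x
      by (auto intro!: derivative_eq_intros d0 d1 simp: algebra_simps power2_eq_square)
    then show ?thesis using deriv0_const by blast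
  qed
  then obtain B where B: "\<And>x. (h1 x - c * h x) * exp (c * x) = B" by blast
  have eq: "2 * c * h x = A * exp (c * x) - B * exp (- c * x)" for x
  proof -
    have "h1 x + c * h x = A * exp (c * x)"
      using A[of x] by (auto simp: exp_minus field_simps)
    moreover have "h1 x - c * h x = B * exp (- c * x)"
      using B[of x] by (auto simp: exp_minus field_simps)
    ultimately show ?thesis by simp
  qed
  obtain M where M: "\<And>x. \<bar>h x\<bar> \<le> M"
    using bnd by (auto simp: bounded_iff)
  have e: "((\<lambda>x. exp (- c * x)) \<longlongrightarrow> 0) at_top"
    using c by real_asymp
  have h0: "((\<lambda>x. h x * exp (- c * x)) \<longlongrightarrow> 0) at_top"
  proof (rule Lim_null_comparison)
    show "((\<lambda>x. M * exp (- c * x)) \<longlongrightarrow> 0) at_top"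
      using tendsto_mult_right_zero[OF e] by simp
  qed (use M in \<open>auto simp: abs_mult intro!: mult_right_mono\<close>)
  have h0': "((\<lambda>x. h (- x) * exp (- c * x)) \<longlongrightarrow> 0) at_top"
  proof (rule Lim_null_comparison)
    show "((\<lambda>x. M * exp (- c * x)) \<longlongrightarrow> 0) at_top"
      using tendsto_mult_right_zero[OF e] by simp
  qed (use M in \<open>auto simp: abs_mult intro!: mult_right_mono\<close>)
  have e2: "((\<lambda>x. exp (- c * x) * exp (- c * x)) \<longlongrightarrow> 0) at_top"
    using tendsto_mult[OF e e] by simp
  have "((\<lambda>x. 2 * c * (h x * exp (- c * x)) + B * (exp (- c * x) * exp (- c * x))) \<longlongrightarrow> 2 * c * 0 + B * 0) at_top"
    by (intro tendsto_intros h0 e2)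
  moreover have "2 * c * (h x * exp (- c * x)) + B * (exp (- c * x) * exp (- c * x)) = A" for x
  proof -
    have "2 * c * (h x * exp (- c * x)) = (A * exp (c * x) - B * exp (- c * x)) * exp (- c * x)"
      using eq[of x] by (simp add: mult.assoc[symmetric])
    then show ?thesis by (simp add: algebra_simps exp_add[symmetric])
  qed
  ultimately have A0: "A = 0"
    using tendsto_const_iff[of "at_top :: real filter" A 0] by simp
  have "((\<lambda>x. - (2 * c * (h (- x) * exp (- c * x))) + A * (exp (- c * x) * exp (- c * x))) \<longlongrightarrow> - (2 * c * 0) + A * 0) at_top"
    by (intro tendsto_intros h0' e2)
  moreover have "- (2 * c * (h (- x) * exp (- c * x))) + A * (exp (- c * x) * exp (- c * x)) = B" for x
  proof -
    have "2 * c * (h (- x) * exp (- c * x)) = (A * exp (- c * x) - B * exp (c * x)) * exp (- c * x)"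
      using eq[of "- x"] by (simp add: mult.assoc[symmetric])
    then show ?thesis by (simp add: algebra_simps exp_add[symmetric])
  qed
  ultimately have "B = 0"
    using tendsto_const_iff[of "at_top :: real filter" B 0] by simp
  with A0 eq[of x] c show ?thesis by simp
qed

lemma smooth_has_deriv:
  assumes "smooth f"
  shows "((deriv ^^ n) f has_real_derivative (deriv ^^ Suc n) f x) (at x)"
  using assms by (simp add: smooth_def DERIV_deriv_iff_real_differentiable)

lemma smooth_diff_derivs:
  assumes "smooth f" "smooth g"
  shows "((\<lambda>x. (deriv ^^ n) f x - (deriv ^^ n) g x) has_real_derivative
    (deriv ^^ Suc n) f x - (deriv ^^ Suc n) g x) (at x)"
  by (intro DERIV_diff smooth_has_deriv assms)

lemma const_null_at_bot:
  fixes h :: fn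
  assumes "\<And>x. (h has_real_derivative 0) (at x)" "(h \<longlongrightarrow> 0) at_bot"
  shows "h x = 0"
proof -
  obtain A where "\<And>x. h x = A"
    using deriv0_const[of h] assms(1) by blast
  moreover from this have "h = (\<lambda>_. A)" by blast
  ultimately show ?thesis
    using assms(2) by (simp add: tendsto_const_iff)
qed

lemma inverse_unique:
  assumes f: "smooth f" "bounded (range f)" "(f \<longlongrightarrow> 0) at_bot"
    and g: "smooth g" "bounded (range g)" "(g \<longlongrightarrow> 0) at_bot"
    and A: "A f = A g" "A \<in> {D, Helm, Cub}"
  shows "f = g"
proof
  fix x
  define h where "h n x = (deriv ^^ n) f x - (deriv ^^ n) g x" for n x
  have d: "(h n has_real_derivative h (Suc n) x) (at x)" for n x
    using smooth_diff_derivs[OF f(1) g(1), of n x] unfolding h_def .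
  have h0: "h 0 = (\<lambda>x. f x - g x)" by (auto simp: h_def)
  have lim: "(h 0 \<longlongrightarrow> 0) at_bot"
    using tendsto_diff[OF f(3) g(3)] by (simp add: h0)
  have bnd: "bounded (range (h 0))"
    using bounded_minus_comp[OF f(2) g(2)] by (simp add: h0)
  consider "A = D" | "A = Helm" | "A = Cub" using A(2) by blast
  then have "h 0 x = 0"
  proof cases
    case 1
    then have "h 1 x = 0" for x using fun_cong[OF A(1), of x] by (simp add: h_def)
    then show ?thesis using d[of 0] lim by (intro const_null_at_bot) simp_all
  next
    case 2
    then have "h 2 x = h 0 x" for x
      using fun_cong[OF A(1), of x] by (simp add: h_def Helm_def)
    then show ?thesis using d[of 0] d[of 1] bnd
      by (intro bounded_hyperbolic_zero[of 1 "h 0" "h 1"]) (simp_all add: numeral_2_eq_2)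
  next
    case 3
    then have h3: "h 3 x = 4 * h 1 x" for x
      using fun_cong[OF A(1), of x] by (simp add: h_def Cub_def)
    have "((\<lambda>x. h 2 x - 4 * h 0 x) has_real_derivative 0) (at x)" for x
      using d[of 2 x] d[of 0 x] h3[of x]
      by (auto intro!: derivative_eq_intros simp: numeral_3_eq_3 numeral_2_eq_2)
    then obtain K where K: "\<And>x. h 2 x - 4 * h 0 x = K"
      using deriv0_const by blast
    have "h 0 x + K / 4 = 0" for x
    proof (rule bounded_hyperbolic_zero[of 2 "\<lambda>x. h 0 x + K / 4" "h 1"])
      show "bounded (range (\<lambda>x. h 0 x + K / 4))"
        using bounded_plus_comp[OF bnd, of "\<lambda>_. K / 4"] by simp
      show "((\<lambda>x. h 0 x + K / 4) has_real_derivative h 1 x) (at x)" for x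
        using d[of 0 x] by (auto intro!: derivative_eq_intros)
      show "(h 1 has_real_derivative 2\<^sup>2 * (h 0 x + K / 4)) (at x)" for x
        using d[of 1 x] K[of x] by (simp add: numeral_2_eq_2 algebra_simps)
    qed simp
    then have "h 0 = (\<lambda>x. - (K / 4))" by (auto simp: eq_neg_iff_add_eq_0)
    then show ?thesis using lim by (intro const_null_at_bot) auto
  qed
  then show "f x = g x" by (simp add: h0)
qed

lemma formal_inverse_eqI:
  assumes "smooth g" "bounded (range g)" "(g \<longlongrightarrow> 0) at_bot"
    and "A g = f" "A \<in> {D, Helm, Cub}"
  shows "formal_inverse A f = g"
  unfolding formal_inverse_def
proof (rule the_equality)
  fix g' assume "smooth g' \<and> bounded (range g') \<and> (g' \<longlongrightarrow> 0) at_bot \<and> A g' = f"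
  then show "g' = g" using assms by (intro inverse_unique[of g' g A]) auto
qed (use assms in auto)

lemma formal_inverse_schwartz:
  assumes f: "schwartz f" and A: "A \<in> {D, Helm, Cub}"
  shows "formal_inverse A (A f) = f"
proof (rule formal_inverse_eqI[OF _ _ _ refl A])
  have b: "bounded (range (\<lambda>x. x ^ k * (deriv ^^ n) f x))" for k n
    using f by (simp add: schwartz_def)
  show "smooth f" using f by (simp add: schwartz_def)
  show "bounded (range f)" using b[of 0 0] by simp
  obtain M where M: "\<And>x. \<bar>x * f x\<bar> \<le> M"
    using b[of 1 0] by (auto simp: bounded_iff)
  show "(f \<longlongrightarrow> 0) at_bot"
  proof (rule Lim_null_comparison)
    show "((\<lambda>x. M / \<bar>x\<bar>) \<longlongrightarrow> 0) at_bot" by real_asymp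
    show "\<forall>\<^sub>F x in at_bot. norm (f x) \<le> M / \<bar>x\<bar>"
      using eventually_gt_at_bot[of "0::real"]
    proof eventually_elim
      case (elim x)
      then show ?case using M[of x] by (simp add: abs_mult field_simps)
    qed
  qed
qed



section \<open>Variational derivatives\<close>

definition has_var_deriv :: "(fn \<Rightarrow> real) \<Rightarrow> fn \<Rightarrow> fn \<Rightarrow> bool" where
  "has_var_deriv F f g \<longleftrightarrow> schwartz g \<and>
     (\<forall>\<phi>. schwartz \<phi> \<longrightarrow>
        ((\<lambda>\<epsilon>. F (\<lambda>x. f x + \<epsilon> * \<phi> x)) has_real_derivative (LBINT x. g x * \<phi> x)) (at 0))"

definition var_deriv :: "(fn \<Rightarrow> real) \<Rightarrow> fn \<Rightarrow> fn" where
  "var_deriv F f = (THE g. has_var_deriv F f g)"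

definition var_differentiable :: "(fn \<Rightarrow> fn \<Rightarrow> fn \<Rightarrow> real) \<Rightarrow> fn \<times> fn \<times> fn \<Rightarrow> bool" where
  "var_differentiable H = (\<lambda>(u, v, w).
     (\<exists>g. has_var_deriv (\<lambda>f. H f v w) u g) \<and>
     (\<exists>g. has_var_deriv (\<lambda>f. H u f w) v g) \<and>
     (\<exists>g. has_var_deriv (\<lambda>f. H u v f) w g))"

definition var_grad :: "(fn \<Rightarrow> fn \<Rightarrow> fn \<Rightarrow> real) \<Rightarrow> fn \<times> fn \<times> fn \<Rightarrow> fn \<times> fn \<times> fn" where
  "var_grad H = (\<lambda>(u, v, w).
     (var_deriv (\<lambda>f. H f v w) u, var_deriv (\<lambda>f. H u f w) v, var_deriv (\<lambda>f. H u v f) w))"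


section \<open>The Hamiltonian functionals\<close>

definition H1 :: "fn \<Rightarrow> fn \<Rightarrow> fn \<Rightarrow> real" where
  "H1 u v w = (let p = Helm_inv v in LBINT x. p x * w x)"

definition H2 :: "fn \<Rightarrow> fn \<Rightarrow> fn \<Rightarrow> real" where
  "H2 u v w = (let p = Helm_inv v; r = Helm_inv w in
     - (LBINT x. (u x)\<^sup>2 * p x * r x + w x * p x * D p x * r x - w x * (p x)\<^sup>2 * D r x))"


section \<open>The Hamiltonian operators\<close>

text \<open>Operator matrices are given by their action on a column
  \<open>(\<xi>\<^sub>1, \<xi>\<^sub>2, \<xi>\<^sub>3)\<close>; they depend on the base point \<open>(u, v, w)\<close>.\<close>

definition opJ :: "fn \<times> fn \<times> fn \<Rightarrow> fn \<times> fn \<times> fn \<Rightarrow> fn \<times> fn \<times> fn" where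
  "opJ = (\<lambda>(u, v, w) (\<xi>\<^sub>1, \<xi>\<^sub>2, \<xi>\<^sub>3).
     (\<lambda>x. (1/2) * D \<xi>\<^sub>1 x,
      \<lambda>x. \<xi>\<^sub>3 x - (D ^^ 2) \<xi>\<^sub>3 x,
      \<lambda>x. (D ^^ 2) \<xi>\<^sub>2 x - \<xi>\<^sub>2 x))"

definition Omega :: "fn \<times> fn \<times> fn \<Rightarrow> fn \<Rightarrow> fn \<times> fn \<times> fn" where
  "Omega = (\<lambda>(u, v, w) s.
     (D (\<lambda>x. u x * s x),
      \<lambda>x. (1/2) * (v x * D s x) + D (\<lambda>y. v y * s y) x,
      \<lambda>x. (1/2) * (w x * D s x) + D (\<lambda>y. w y * s y) x))"

definition Omega_adj :: "fn \<times> fn \<times> fn \<Rightarrow> fn \<times> fn \<times> fn \<Rightarrow> fn" where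
  "Omega_adj = (\<lambda>(u, v, w) (\<xi>\<^sub>1, \<xi>\<^sub>2, \<xi>\<^sub>3). \<lambda>x.
     - (u x * D \<xi>\<^sub>1 x)
     + (- (1/2) * D (\<lambda>y. v y * \<xi>\<^sub>2 y) x - v x * D \<xi>\<^sub>2 x)
     + (- (1/2) * D (\<lambda>y. w y * \<xi>\<^sub>3 y) x - w x * D \<xi>\<^sub>3 x))"

definition opK :: "fn \<times> fn \<times> fn \<Rightarrow> fn \<times> fn \<times> fn \<Rightarrow> fn \<times> fn \<times> fn" where
  "opK = (\<lambda>(u, v, w) (\<xi>\<^sub>1, \<xi>\<^sub>2, \<xi>\<^sub>3).
     let (\<omega>\<^sub>1, \<omega>\<^sub>2, \<omega>\<^sub>3) = Omega (u, v, w) (Cub_inv (Omega_adj (u, v, w) (\<xi>\<^sub>1, \<xi>\<^sub>2, \<xi>\<^sub>3)));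
         vv = (\<lambda>x. (3/2) * (v x * Dinv (\<lambda>y. v y * \<xi>\<^sub>2 y) x));
         vw = (\<lambda>x. - ((u x)\<^sup>2 * \<xi>\<^sub>3 x) - (3/2) * (v x * Dinv (\<lambda>y. w y * \<xi>\<^sub>3 y) x));
         wv = (\<lambda>x. (u x)\<^sup>2 * \<xi>\<^sub>2 x - (3/2) * (w x * Dinv (\<lambda>y. v y * \<xi>\<^sub>2 y) x));
         ww = (\<lambda>x. (3/2) * (w x * Dinv (\<lambda>y. w y * \<xi>\<^sub>3 y) x))
     in (\<lambda>x. - 2 * \<omega>\<^sub>1 x,
         \<lambda>x. vv x + vw x - 2 * \<omega>\<^sub>2 x,
         \<lambda>x. wv x + ww x - 2 * \<omega>\<^sub>3 x))"


section \<open>Evolution equations\<close>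

text \<open>Functions of \<open>(x, t)\<close> are curves \<open>f :: real \<Rightarrow> fn\<close> with \<open>f t x\<close> the value at
  position \<open>x\<close> and time \<open>t\<close>. Both predicates below include the existence of the time
  derivatives.\<close>

definition has_time_deriv :: "(real \<Rightarrow> fn) \<Rightarrow> fn \<Rightarrow> real \<Rightarrow> bool" where
  "has_time_deriv f g t \<longleftrightarrow> (\<forall>x. ((\<lambda>s. f s x) has_real_derivative g x) (at t))"

definition novikov3_at :: "(real \<Rightarrow> fn) \<Rightarrow> (real \<Rightarrow> fn) \<Rightarrow> (real \<Rightarrow> fn) \<Rightarrow> real \<Rightarrow> bool" where
  "novikov3_at u p r t \<longleftrightarrow>
     (let v = (\<lambda>s. Helm (p s)); w = (\<lambda>s. Helm (r s)) in
      \<exists>u\<^sub>t v\<^sub>t w\<^sub>t. has_time_deriv u u\<^sub>t t \<and> has_time_deriv v v\<^sub>t t \<and> has_time_deriv w w\<^sub>t t \<and>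
        (\<forall>x. u\<^sub>t x + D (\<lambda>y. u t y * p t y * r t y) x = 0) \<and>
        (\<forall>x. v\<^sub>t x + 3 * v t x * D (p t) x * r t x + D (v t) x * p t x * r t x
              + (u t x)\<^sup>2 * p t x = 0) \<and>
        (\<forall>x. w\<^sub>t x + 3 * w t x * p t x * D (r t) x + D (w t) x * p t x * r t x
              - (u t x)\<^sup>2 * r t x = 0))"

definition hamiltonian_form_at ::
  "(fn \<times> fn \<times> fn \<Rightarrow> fn \<times> fn \<times> fn \<Rightarrow> fn \<times> fn \<times> fn) \<Rightarrow> (fn \<Rightarrow> fn \<Rightarrow> fn \<Rightarrow> real) \<Rightarrow>
   (real \<Rightarrow> fn) \<Rightarrow> (real \<Rightarrow> fn) \<Rightarrow> (real \<Rightarrow> fn) \<Rightarrow> real \<Rightarrow> bool" where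
  "hamiltonian_form_at P H u v w t \<longleftrightarrow>
     (let (a, b, c) = P (u t, v t, w t) (var_grad H (u t, v t, w t)) in
      has_time_deriv u a t \<and> has_time_deriv v b t \<and> has_time_deriv w c t)"

end

(*
  With q_v and q_w the Schwartz solutions of Helm q_v = w_x p r + 3 w p r_x - u^2 r and
  Helm q_w = -(3 v p_x r + v_x p r + u^2 p), integration by parts gives
  grad H2 = (-2 u p r, q_v, q_w), so J grad H2 is the right-hand side of the system.
  For K, grad H1 = (0, r, p). Two identities remove the nonlocal terms:
  Omega^* (0, r, p) = (D^3 - 4 D) (p r / 2) and v r - w p = D (p r_x - p_x r).
  The analytic input is that 1 - D^2 is onto on Schwartz functions; it is needed both for
  q_v, q_w and to write every test direction in v or w as Helm of a Schwartz function.
*)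
theory Submission
  imports Defs "HOL-Probability.Sinc_Integral"
begin

section \<open>Schwartz functions\<close>

text \<open>\<open>Helm_inv\<close> is a definite description, so it can be evaluated only at
  functions already exhibited as \<open>Helm\<close> of something. This shapes the variational part.
  A direction \<open>\<phi>\<close> in v is written as \<open>Helm \<psi>\<close>; the path
  \<open>v + \<epsilon> * \<phi>\<close> then lifts to the straight path
  \<open>p + \<epsilon> * \<psi>\<close>, along which the Hamiltonians are polynomials in
  \<open>\<epsilon>\<close> of degree at most two. Their derivative at 0 is a coefficient, and
  differentiation under the integral sign never arises. The lift also explains the equations for q_v
  and q_w: \<open>1 - D^2\<close> is symmetric, so the integrals of \<open>q * Helm \<psi>\<close>
  and \<open>Helm q * \<psi>\<close> agree, and \<open>Helm q\<close> has to be the derivative of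
  \<open>H2\<close> with respect to p or r. For K the obstacle is that the antiderivatives of
  \<open>v * r\<close> and \<open>w * p\<close> have in general a nonzero limit at plus infinity,
  hence leave the Schwartz class. Only their difference enters the result, and that is Schwartz; but
  \<open>opK\<close> names them separately, so each must first be shown to exist.\<close>

definition rapid :: "fn \<Rightarrow> bool" where
  "rapid f \<longleftrightarrow> (\<forall>k. bounded (range (\<lambda>x. x ^ k * f x)))"

lemma rapid_add:
  assumes "rapid f" "rapid g"
  shows "rapid (\<lambda>x. f x + g x)"
  using assms by (auto simp: rapid_def distrib_left intro: bounded_plus_comp)

lemma rapid_mult:
  assumes "rapid f" "rapid g"
  shows "rapid (\<lambda>x. f x * g x)"
  unfolding rapid_def
proof
  fix k
  obtain M where M: "\<And>x. \<bar>x ^ k * f x\<bar> \<le> M"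
    using assms(1) by (auto simp: rapid_def bounded_iff)
  obtain N where N: "\<And>x. \<bar>x ^ 0 * g x\<bar> \<le> N"
    using assms(2) unfolding rapid_def bounded_iff by (metis rangeI real_norm_def)
  have "\<bar>x ^ k * (f x * g x)\<bar> \<le> M * N" for x
  proof -
    have "\<bar>x ^ k * f x\<bar> * \<bar>g x\<bar> \<le> M * N"
      by (rule mult_mono) (use M[of x] N[of x] in auto)
    then show ?thesis by (simp add: abs_mult mult.assoc)
  qed
  then show "bounded (range (\<lambda>x. x ^ k * (f x * g x)))"
    by (auto simp: bounded_iff)
qed

lemma rapid_cmult: "rapid f \<Longrightarrow> rapid (\<lambda>x. c * f x)"
  unfolding rapid_def
proof
  fix k
  assume "\<forall>k. bounded (range (\<lambda>x. x ^ k * f x))"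
  then obtain M where M: "\<And>x. \<bar>x ^ k * f x\<bar> \<le> M"
    by (auto simp: bounded_iff)
  have "\<bar>x ^ k * (c * f x)\<bar> \<le> \<bar>c\<bar> * M" for x
    using mult_left_mono[OF M[of x], of "\<bar>c\<bar>"] by (simp add: abs_mult mult_ac)
  then show "bounded (range (\<lambda>x. x ^ k * (c * f x)))"
    by (auto simp: bounded_iff)
qed

lemma rapid_reflect:
  assumes "rapid f"
  shows "rapid (\<lambda>x. f (- x))"
  unfolding rapid_def
proof
  fix k
  obtain M where M: "\<And>x. \<bar>x ^ k * f x\<bar> \<le> M"
    using assms by (auto simp: rapid_def bounded_iff)
  have "\<bar>x ^ k * f (- x)\<bar> \<le> M" for x
    using M[of "- x"] by (simp add: abs_mult power_abs)
  then show "bounded (range (\<lambda>x. x ^ k * f (- x)))"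
    by (auto simp: bounded_iff)
qed

text \<open>\<open>schwartz\<close> speaks of iterated derivatives, where products would require the
  general Leibniz rule. Truncating at order \<open>n\<close> and recursing on \<open>deriv f\<close>
  leaves only the first-order rules to apply, and it allows regularity to be gained one order at a
  time from a differential equation.\<close>

primrec schwartz_upto :: "nat \<Rightarrow> fn \<Rightarrow> bool" where
  "schwartz_upto 0 f \<longleftrightarrow> (\<forall>x. f differentiable (at x)) \<and> rapid f"
| "schwartz_upto (Suc n) f \<longleftrightarrow> (\<forall>x. f differentiable (at x)) \<and> rapid f \<and> schwartz_upto n (deriv f)"

lemma schwartz_upto_iff:
  "schwartz_upto n f \<longleftrightarrow>
    (\<forall>m\<le>n. (\<forall>x. (deriv ^^ m) f differentiable (at x)) \<and> rapid ((deriv ^^ m) f))"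
proof (induction n arbitrary: f)
  case (Suc n)
  have "(\<forall>m\<le>Suc n. P m) \<longleftrightarrow> P 0 \<and> (\<forall>m\<le>n. P (Suc m))" for P
    by (metis Suc_le_mono le0 not0_implies_Suc)
  then show ?case
    using Suc by (simp add: funpow_swap1 del: funpow.simps(2) add: funpow_Suc_right)
qed simp

lemma schwartz_iff_upto: "schwartz f \<longleftrightarrow> (\<forall>n. schwartz_upto n f)"
  by (auto simp: schwartz_def smooth_def rapid_def schwartz_upto_iff)

lemma schwartz_upto_weaken: "schwartz_upto (Suc n) f \<Longrightarrow> schwartz_upto n f"
  by (auto simp: schwartz_upto_iff)

lemma schwartz_uptoI:
  assumes "\<And>x. (f has_real_derivative f' x) (at x)" "rapid f"
    and "\<And>m. n = Suc m \<Longrightarrow> schwartz_upto m f'"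
  shows "schwartz_upto n f"
proof -
  have "deriv f = f'" using assms(1) by (auto intro: DERIV_imp_deriv)
  moreover have "schwartz_upto 0 f"
    using assms(1,2) by (auto simp: real_differentiable_def)
  ultimately show ?thesis using assms(3) by (cases n) auto
qed

lemma schwartz_upto_DERIV:
  "schwartz_upto n f \<Longrightarrow> (f has_real_derivative deriv f x) (at x)"
  by (cases n) (auto simp: DERIV_deriv_iff_real_differentiable)

lemma schwartz_upto_rapid: "schwartz_upto n f \<Longrightarrow> rapid f"
  by (cases n) auto

lemma schwartz_upto_add:
  "schwartz_upto n f \<Longrightarrow> schwartz_upto n g \<Longrightarrow> schwartz_upto n (\<lambda>x. f x + g x)"
proof (induction n arbitrary: f g rule: less_induct)
  case (less n)
  show ?case
  proof (rule schwartz_uptoI)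
    show "((\<lambda>x. f x + g x) has_real_derivative deriv f x + deriv g x) (at x)" for x
      using less.prems by (blast intro: DERIV_add schwartz_upto_DERIV)
    show "rapid (\<lambda>x. f x + g x)"
      using less.prems by (blast intro: rapid_add schwartz_upto_rapid)
  qed (use less in auto)
qed

lemma schwartz_upto_cmult:
  "schwartz_upto n f \<Longrightarrow> schwartz_upto n (\<lambda>x. c * f x)"
proof (induction n arbitrary: f rule: less_induct)
  case (less n)
  show ?case
  proof (rule schwartz_uptoI)
    show "((\<lambda>x. c * f x) has_real_derivative c * deriv f x) (at x)" for x
      using less.prems by (blast intro: DERIV_cmult schwartz_upto_DERIV)
    show "rapid (\<lambda>x. c * f x)"
      using less.prems by (blast intro: rapid_cmult schwartz_upto_rapid)
  qed (use less in auto)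
qed

lemma schwartz_upto_mult:
  "schwartz_upto n f \<Longrightarrow> schwartz_upto n g \<Longrightarrow> schwartz_upto n (\<lambda>x. f x * g x)"
proof (induction n arbitrary: f g rule: less_induct)
  case (less n)
  show ?case
  proof (rule schwartz_uptoI)
    show "((\<lambda>x. f x * g x) has_real_derivative deriv f x * g x + deriv g x * f x) (at x)" for x
      using less.prems by (blast intro: DERIV_mult schwartz_upto_DERIV)
    show "rapid (\<lambda>x. f x * g x)"
      using less.prems by (blast intro: rapid_mult schwartz_upto_rapid)
    \<comment> \<open>The factors that are not differentiated are still of order
      \<open>Suc m\<close> and are weakened to \<open>m\<close>, so that both factors of each
      product meet the induction hypothesis.\<close>
    show "schwartz_upto m (\<lambda>x. deriv f x * g x + deriv g x * f x)" if "n = Suc m" for m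
      using less.prems that
      by (intro schwartz_upto_add less.IH) (auto intro: schwartz_upto_weaken)
  qed
qed

lemma schwartz_upto_reflect:
  "schwartz_upto n f \<Longrightarrow> schwartz_upto n (\<lambda>x. f (- x))"
proof (induction n arbitrary: f rule: less_induct)
  case (less n)
  show ?case
  proof (rule schwartz_uptoI)
    show "((\<lambda>x. f (- x)) has_real_derivative (- 1) * deriv f (- x)) (at x)" for x
      using schwartz_upto_DERIV[OF less.prems, of "- x"] by (simp add: DERIV_mirror)
    show "rapid (\<lambda>x. f (- x))"
      using less.prems by (blast intro: rapid_reflect schwartz_upto_rapid)
    show "schwartz_upto m (\<lambda>x. (- 1) * deriv f (- x))" if "n = Suc m" for m
      using less.prems that by (intro schwartz_upto_cmult less.IH) auto
  qed
qed

named_theorems schwartz_intros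

lemma schwartz_add [schwartz_intros]:
  "schwartz f \<Longrightarrow> schwartz g \<Longrightarrow> schwartz (\<lambda>x. f x + g x)"
  by (simp add: schwartz_iff_upto schwartz_upto_add)

lemma schwartz_mult [schwartz_intros]:
  "schwartz f \<Longrightarrow> schwartz g \<Longrightarrow> schwartz (\<lambda>x. f x * g x)"
  by (simp add: schwartz_iff_upto schwartz_upto_mult)

lemma schwartz_cmult [schwartz_intros]: "schwartz f \<Longrightarrow> schwartz (\<lambda>x. c * f x)"
  by (simp add: schwartz_iff_upto schwartz_upto_cmult)

lemma schwartz_minus [schwartz_intros]: "schwartz f \<Longrightarrow> schwartz (\<lambda>x. - f x)"
  using schwartz_cmult[of f "- 1"] by simp

lemma schwartz_diff [schwartz_intros]:
  "schwartz f \<Longrightarrow> schwartz g \<Longrightarrow> schwartz (\<lambda>x. f x - g x)"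
  using schwartz_add[OF _ schwartz_minus, of f g] by simp

lemma schwartz_power2 [schwartz_intros]: "schwartz f \<Longrightarrow> schwartz (\<lambda>x. (f x)\<^sup>2)"
  using schwartz_mult[of f f] by (simp add: power2_eq_square)

lemma schwartz_zero [schwartz_intros]: "schwartz (\<lambda>x. 0)"
proof -
  have "(deriv ^^ n) (\<lambda>x::real. 0 :: real) = (\<lambda>x. 0)" for n
    by (induction n) auto
  then show ?thesis by (auto simp: schwartz_def smooth_def)
qed

lemma schwartz_reflect: "schwartz f \<Longrightarrow> schwartz (\<lambda>x. f (- x))"
  by (simp add: schwartz_iff_upto schwartz_upto_reflect)

lemma schwartz_deriv [schwartz_intros]: "schwartz f \<Longrightarrow> schwartz (deriv f)"
  unfolding schwartz_iff_upto by (metis schwartz_upto.simps(2))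

lemma schwartz_DERIV: "schwartz f \<Longrightarrow> (f has_real_derivative deriv f x) (at x)"
  using schwartz_upto_DERIV unfolding schwartz_iff_upto by blast

lemma schwartz_rapid: "schwartz f \<Longrightarrow> rapid f"
  using schwartz_upto_rapid unfolding schwartz_iff_upto by blast

lemma schwartz_bounded:
  assumes "schwartz f"
  obtains M where "\<And>x. \<bar>x ^ k * f x\<bar> \<le> M"
  using schwartz_rapid[OF assms] by (auto simp: rapid_def bounded_iff)

lemma schwartz_smooth: "schwartz f \<Longrightarrow> smooth f"
  by (simp add: schwartz_def)

lemma schwartz_isCont: "schwartz f \<Longrightarrow> isCont f x"
  using DERIV_isCont schwartz_DERIV by blast

section \<open>Limits and integrals of Schwartz functions\<close>

lemma schwartz_at_top:
  assumes "schwartz f"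
  shows "(f \<longlongrightarrow> 0) at_top"
proof -
  obtain M where M: "\<And>x. \<bar>x ^ 1 * f x\<bar> \<le> M"
    using schwartz_bounded[OF assms] by blast
  show ?thesis
  proof (rule Lim_null_comparison)
    show "((\<lambda>x. M / \<bar>x\<bar>) \<longlongrightarrow> 0) at_top" by real_asymp
    show "\<forall>\<^sub>F x in at_top. norm (f x) \<le> M / \<bar>x\<bar>"
      using eventually_gt_at_top[of "0::real"]
    proof eventually_elim
      case (elim x)
      then show ?case using M[of x] by (simp add: abs_mult field_simps)
    qed
  qed
qed

lemma schwartz_at_bot:
  assumes "schwartz f"
  shows "(f \<longlongrightarrow> 0) at_bot"
  using schwartz_at_top[OF schwartz_reflect[OF assms]]
  by (simp add: filterlim_at_bot_mirror)

text \<open>The bounds on \<open>f x\<close> and \<open>x ^ 2 * f x\<close> add up to this one. The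
  majorant is integrable and has the explicit antiderivative \<open>M * arctan x\<close>, which
  later controls antiderivatives of \<open>f\<close>.\<close>

lemma schwartz_cauchy_bound:
  assumes "schwartz f"
  obtains M where "\<And>x. \<bar>f x\<bar> \<le> M * inverse (1 + x\<^sup>2)"
proof -
  obtain M where M: "\<And>x. \<bar>x ^ 0 * f x\<bar> \<le> M"
    using schwartz_bounded[OF assms] by blast
  obtain N where N: "\<And>x. \<bar>x ^ 2 * f x\<bar> \<le> N"
    using schwartz_bounded[OF assms] by blast
  have "\<bar>f x\<bar> \<le> (M + N) * inverse (1 + x\<^sup>2)" for x
  proof -
    have "(1 + x\<^sup>2) * \<bar>f x\<bar> \<le> M + N"
      using M[of x] N[of x] by (simp add: abs_mult distrib_right)
    moreover have "0 < 1 + x\<^sup>2" by (simp add: add_pos_nonneg)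
    ultimately show ?thesis by (simp add: field_simps)
  qed
  then show ?thesis using that by blast
qed

lemma schwartz_integrable:
  assumes "schwartz f"
  shows "integrable lborel f"
proof -
  obtain M where M: "\<And>x. \<bar>f x\<bar> \<le> M * inverse (1 + x\<^sup>2)"
    using schwartz_cauchy_bound[OF assms] by blast
  have "integrable lborel (\<lambda>x. M * inverse (1 + x\<^sup>2))"
    using integrable_inverse_1_plus_square
    by (auto simp: set_integrable_def)
  then show ?thesis
  proof (rule Bochner_Integration.integrable_bound)
    have "continuous_on UNIV f"
      using schwartz_isCont[OF assms] by (simp add: continuous_at_imp_continuous_on)
    then show "f \<in> borel_measurable lborel"
      using borel_measurable_continuous_onI by simp
    show "AE x in lborel. norm (f x) \<le> norm (M * inverse (1 + x\<^sup>2))"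
      using M by (intro AE_I2) (metis abs_ge_self order_trans real_norm_def)
  qed
qed

text \<open>The form in which integration by parts is used: two integrands have the same integral
  once a Schwartz primitive \<open>K\<close> of their difference is exhibited.\<close>

lemma integral_schwartz_derivative:
  assumes K: "schwartz K" and h: "schwartz h"
    and d: "\<And>x. (K has_real_derivative h x) (at x)"
  shows "(LBINT x. h x) = 0"
proof -
  have "(LBINT x=-\<infinity>..\<infinity>. h x) = 0 - 0"
  proof (rule interval_integral_FTC_integrable)
    show "((K \<circ> real_of_ereal) \<longlongrightarrow> 0) (at_right (- \<infinity>))"
      using schwartz_at_bot[OF K] by (simp add: ereal_tendsto_simps)
    show "((K \<circ> real_of_ereal) \<longlongrightarrow> 0) (at_left \<infinity>)"
      using schwartz_at_top[OF K] by (simp add: ereal_tendsto_simps)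
    show "set_integrable lborel (einterval (- \<infinity>) \<infinity>) h"
      using schwartz_integrable[OF h] by (simp add: set_integrable_def)
  qed (use d schwartz_isCont[OF h] in \<open>auto simp: has_real_derivative_iff_has_vector_derivative\<close>)
  then show ?thesis by (simp add: interval_lebesgue_integral_def set_lebesgue_integral_def)
qed

text \<open>The zero set of \<open>h\<close> is closed and has full measure; its open complement
  would have positive measure if it were nonempty.\<close>

lemma integral_square_zero:
  assumes "schwartz h" "(LBINT x. h x * h x) = 0"
  shows "h x = 0"
proof -
  have "AE x in lborel. h x * h x = 0"
    using assms schwartz_integrable[OF schwartz_mult[OF assms(1) assms(1)]]
    by (subst (asm) integral_nonneg_eq_0_iff_AE) auto
  then have "AE x in lebesgue. x \<in> {x. h x = 0}"
    by (intro AE_completion) simp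
  moreover have "closed {x. h x = 0}"
    using schwartz_isCont[OF assms(1)]
    by (intro closed_Collect_eq) (auto intro: continuous_at_imp_continuous_on)
  ultimately show ?thesis using mem_closed_if_AE_lebesgue by blast
qed


section \<open>Existence of the formal inverses\<close>

lemma continuous_antiderivative:
  fixes f :: fn
  assumes "\<And>x. isCont f x"
  obtains F where "\<And>x. (F has_real_derivative f x) (at x)"
  using einterval_antiderivative[of "- \<infinity>" "\<infinity>" f] assms
  by (auto simp: has_real_derivative_iff_has_vector_derivative)

lemma mono_bounded_at_top:
  fixes F :: fn
  assumes "mono F" "\<And>x. F x \<le> B"
  obtains L where "(F \<longlongrightarrow> L) at_top" "\<And>x. F x \<le> L"
proof
  have bdd: "bdd_above (range F)" using assms(2) by (auto simp: bdd_above_def)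
  show le: "F x \<le> (SUP x. F x)" for x
    using bdd by (intro cSUP_upper) auto
  show "(F \<longlongrightarrow> (SUP x. F x)) at_top"
  proof (rule order_tendstoI)
    fix a assume "a < (SUP x. F x)"
    then obtain y where "a < F y" using less_cSUP_iff[OF _ bdd] by auto
    moreover have "\<forall>\<^sub>F x in at_top. F y \<le> F x"
      using eventually_ge_at_top[of y] by eventually_elim (rule monoD[OF assms(1)])
    ultimately show "\<forall>\<^sub>F x in at_top. a < F x"
      by (auto elim: eventually_mono)
  next
    fix a assume "a > (SUP x. F x)"
    then show "\<forall>\<^sub>F x in at_top. F x < a"
      using le by (intro always_eventually) (auto intro: le_less_trans)
  qed
qed

lemma mono_if_deriv_nonneg:
  fixes F :: fn
  assumes "\<And>x. (F has_real_derivative f x) (at x)" "\<And>x. 0 \<le> f x"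
  shows "mono F"
proof (rule monoI)
  fix x y :: real assume "x \<le> y"
  then show "F x \<le> F y"
    by (rule DERIV_nonneg_imp_nondecreasing) (use assms in blast)
qed

lemma mono_bounded_at_bot:
  fixes F :: fn
  assumes "mono F" "\<And>x. B \<le> F x"
  obtains L where "(F \<longlongrightarrow> L) at_bot"
proof -
  have "mono (\<lambda>x. - F (- x))"
    using assms(1) by (simp add: mono_def)
  then obtain L where "((\<lambda>x. - F (- x)) \<longlongrightarrow> L) at_top"
    by (rule mono_bounded_at_top[of "\<lambda>x. - F (- x)" "- B"]) (use assms(2) in auto)
  then have "((\<lambda>x. F (- x)) \<longlongrightarrow> - L) at_top"
    using tendsto_minus by fastforce
  then show ?thesis using that by (simp add: filterlim_at_bot_mirror)
qed

lemma antiderivative_zero_at_bot: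
  assumes f: "schwartz f"
  obtains F where "smooth F" "bounded (range F)" "(F \<longlongrightarrow> 0) at_bot" "deriv F = f"
proof -
  obtain M where M: "\<And>x. \<bar>f x\<bar> \<le> M * inverse (1 + x\<^sup>2)"
    using schwartz_cauchy_bound[OF f] by blast
  obtain F where F: "\<And>x. (F has_real_derivative f x) (at x)"
    using continuous_antiderivative schwartz_isCont[OF f] by blast
  \<comment> \<open>Since \<open>\<bar>f x\<bar>\<close> is at most the derivative of
    \<open>M * arctan x\<close>, both \<open>U\<close> and \<open>V\<close> are nondecreasing.
    Comparing with their values at 0 bounds \<open>F\<close>, and monotonicity of \<open>U\<close>
    yields the limit of \<open>F\<close> at minus infinity that is subtracted in
    \<open>G\<close>.\<close>
  define U where "U x = F x + M * arctan x" for x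
  define V where "V x = - F x + M * arctan x" for x
  have M0: "0 \<le> M" using M[of 0] by simp
  have dU: "(U has_real_derivative (f x + M * inverse (1 + x\<^sup>2))) (at x)" for x
    unfolding U_def by (auto intro!: derivative_eq_intros F)
  have dV: "(V has_real_derivative (- f x + M * inverse (1 + x\<^sup>2))) (at x)" for x
    unfolding V_def by (auto intro!: derivative_eq_intros F)
  have nonneg: "0 \<le> f x + M * inverse (1 + x\<^sup>2)" "0 \<le> - f x + M * inverse (1 + x\<^sup>2)" for x
    using M[of x] by linarith+
  have U: "mono U" by (rule mono_if_deriv_nonneg[OF dU nonneg(1)])
  have V: "mono V" by (rule mono_if_deriv_nonneg[OF dV nonneg(2)])
  have at: "\<bar>M * arctan x\<bar> \<le> M * (pi / 2)" for x
    using arctan_lbound[of x] arctan_ubound[of x] M0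
    unfolding abs_mult by (intro mult_mono) auto
  define C where "C = \<bar>F 0\<bar> + M * (pi / 2)"
  have FC: "\<bar>F x\<bar> \<le> C" for x
  proof -
    have "\<bar>F x - F 0\<bar> \<le> \<bar>M * arctan x\<bar>"
    proof (cases "0 \<le> x")
      case True
      then show ?thesis using monoD[OF U True] monoD[OF V True] by (simp add: U_def V_def)
    next
      case False
      then have "x \<le> 0" by simp
      then show ?thesis using monoD[OF U, of x 0] monoD[OF V, of x 0]
        by (simp add: U_def V_def)
    qed
    then show ?thesis using at[of x] by (simp add: C_def)
  qed
  have "- C - M * (pi / 2) \<le> U x" for x
    using FC[of x] at[of x] by (simp add: U_def)
  then obtain L where L: "(U \<longlongrightarrow> L) at_bot"
    using mono_bounded_at_bot[OF U] by blast
  have "((\<lambda>x. U x - M * arctan x) \<longlongrightarrow> L - M * (- (pi / 2))) at_bot"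
    by (intro tendsto_intros L tendsto_arctan_at_bot)
  then have lim: "(F \<longlongrightarrow> L + M * (pi / 2)) at_bot" by (simp add: U_def)
  define G where "G x = F x - (L + M * (pi / 2))" for x
  have dG: "(G has_real_derivative f x) (at x)" for x
    unfolding G_def by (auto intro!: derivative_eq_intros F)
  then have G': "deriv G = f" by (auto intro: DERIV_imp_deriv)
  show ?thesis
  proof (rule that[of G])
    show "smooth G" unfolding smooth_def
    proof (intro allI)
      fix n x
      show "(deriv ^^ n) G differentiable at x"
      proof (cases n)
        case 0
        then show ?thesis using dG by (auto simp: real_differentiable_def)
      next
        case (Suc m)
        then have "(deriv ^^ n) G = (deriv ^^ m) f"
          by (simp add: funpow_Suc_right G' del: funpow.simps(2))
        then show ?thesis using schwartz_smooth[OF f] by (simp add: smooth_def)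
      qed
    qed
    show "bounded (range G)" unfolding G_def
      using FC by (intro bounded_minus_comp) (auto simp: bounded_iff)
    show "(G \<longlongrightarrow> 0) at_bot"
      using tendsto_diff[OF lim tendsto_const[of "L + M * (pi / 2)"]] unfolding G_def by simp
  qed (rule G')
qed

text \<open>\<open>(h - M) exp (- x)\<close> is nondecreasing and vanishes at infinity.\<close>

lemma growth_ode_le:
  fixes h s :: fn
  assumes d: "\<And>x. (h has_real_derivative h x - s x) (at x)"
    and s: "\<And>x. s x \<le> M" and lim: "((\<lambda>x. h x * exp (- x)) \<longlongrightarrow> 0) at_top"
  shows "h x \<le> M"
proof -
  define e where "e x = (h x - M) * exp (- x)" for x
  have "(e has_real_derivative (M - s x) * exp (- x)) (at x)" for x
    unfolding e_def by (auto intro!: derivative_eq_intros d simp: algebra_simps)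
  then have mono: "mono e"
    by (rule mono_if_deriv_nonneg) (use s in auto)
  have "((\<lambda>x. exp (- x)) \<longlongrightarrow> (0::real)) at_top" by real_asymp
  from tendsto_diff[OF lim tendsto_mult_right_zero[OF this, of M]]
  have "(e \<longlongrightarrow> 0) at_top" unfolding e_def by (simp add: left_diff_distrib)
  then have "e x \<le> 0"
  proof (rule tendsto_lowerbound)
    show "\<forall>\<^sub>F y in at_top. e x \<le> e y"
      using eventually_ge_at_top[of x] by eventually_elim (rule monoD[OF mono])
  qed simp
  then show ?thesis by (simp add: e_def mult_le_0_iff)
qed

text \<open>The homogeneous solutions are the multiples of \<open>exp x\<close>; the limit condition
  excludes them, and what remains inherits the bound of the source. This is applied to the moments
  \<open>x ^ k * A x\<close>.\<close>

lemma growth_ode_bound: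
  fixes h s :: fn
  assumes d: "\<And>x. (h has_real_derivative h x - s x) (at x)"
    and s: "\<And>x. \<bar>s x\<bar> \<le> M" and lim: "((\<lambda>x. h x * exp (- x)) \<longlongrightarrow> 0) at_top"
  shows "\<bar>h x\<bar> \<le> M"
proof -
  have "h x \<le> M" using s by (intro growth_ode_le[OF d _ lim]) (auto simp: abs_le_iff)
  moreover have "- h x \<le> M"
  proof (rule growth_ode_le[of "\<lambda>x. - h x" "\<lambda>x. - s x"])
    show "((\<lambda>x. - h x) has_real_derivative - h x - (- s x)) (at x)" for x
      by (auto intro!: derivative_eq_intros d)
    show "((\<lambda>x. - h x * exp (- x)) \<longlongrightarrow> 0) at_top"
      using tendsto_minus[OF lim] by simp
  qed (use s in \<open>auto simp: abs_le_iff\<close>)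
  ultimately show ?thesis by simp
qed

lemma bounded_growth_ode_solution:
  fixes f :: fn
  assumes cont: "\<And>x. isCont f x" and M: "\<And>x. \<bar>f x\<bar> \<le> M"
  obtains A where "\<And>x. (A has_real_derivative A x - f x) (at x)" "bounded (range A)"
proof -
  \<comment> \<open>The shift by \<open>M\<close> makes the source nonnegative. The antiderivative
    \<open>F\<close> of the weighted source is then monotone, so its limit \<open>L\<close> exists
    as a supremum; the bound \<open>2 * M\<close> controls the distance from \<open>F x\<close> to
    \<open>L\<close>.\<close>
  have fM: "0 \<le> f x + M" "f x + M \<le> 2 * M" for x
    using M[of x] by (auto simp: abs_le_iff)
  have "isCont (\<lambda>x. exp (- x) * (f x + M)) x" for x
    by (intro continuous_intros cont)
  then obtain F where F: "\<And>x. (F has_real_derivative exp (- x) * (f x + M)) (at x)"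
    using continuous_antiderivative by blast
  have F1: "mono F" by (rule mono_if_deriv_nonneg[OF F]) (use fM in auto)
  have F2: "mono (\<lambda>x. - F x - 2 * M * exp (- x))"
  proof (rule mono_if_deriv_nonneg)
    show "((\<lambda>x. - F x - 2 * M * exp (- x)) has_real_derivative
        exp (- x) * (2 * M - (f x + M))) (at x)" for x
      by (auto intro!: derivative_eq_intros F simp: algebra_simps)
  qed (use fM in simp)
  have M0: "0 \<le> M" using M[of 0] by linarith
  have le: "F y \<le> F x + 2 * M * exp (- x)" for x y
  proof (cases "x \<le> y")
    case True
    have "0 \<le> 2 * M * exp (- y)" using M0 by simp
    then show ?thesis using monoD[OF F2 True] by simp
  next
    case False
    have "0 \<le> 2 * M * exp (- x)" using M0 by simp
    then show ?thesis using monoD[OF F1, of y x] False by simp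
  qed
  obtain L where L: "(F \<longlongrightarrow> L) at_top" "\<And>x. F x \<le> L"
    using mono_bounded_at_top[OF F1 le[of _ 0]] by blast
  have L2: "L \<le> F x + 2 * M * exp (- x)" for x
    using le by (intro tendsto_upperbound[OF L(1)]) auto
  \<comment> \<open>This is \<open>exp x\<close> times the integral of
    \<open>exp (- y) * f y\<close> over \<open>y \<ge> x\<close>: the tail \<open>L - F x\<close>
    belongs to \<open>f + M\<close>, and the constant \<open>M\<close> contributes exactly
    \<open>M\<close>.\<close>
  define A where "A x = exp x * (L - F x) - M" for x
  show ?thesis
  proof (rule that[of A])
    show "(A has_real_derivative A x - f x) (at x)" for x
      unfolding A_def
      by (auto intro!: derivative_eq_intros F simp: algebra_simps exp_add[symmetric])
    have "\<bar>A x\<bar> \<le> M" for x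
    proof -
      have "0 \<le> exp x * (L - F x)" using L(2) by simp
      moreover have "exp x * (L - F x) \<le> exp x * (2 * M * exp (- x))"
        using L2[of x] by (intro mult_left_mono) auto
      moreover have "exp x * (2 * M * exp (- x)) = 2 * M"
        by (simp add: exp_minus)
      ultimately show ?thesis by (simp add: A_def)
    qed
    then show "bounded (range A)" by (auto simp: bounded_iff)
  qed
qed

lemma schwartz_growth_ode:
  assumes f: "schwartz f"
  obtains A where "schwartz A" "\<And>x. (A has_real_derivative A x - f x) (at x)"
proof -
  obtain M where "\<And>x. \<bar>x ^ 0 * f x\<bar> \<le> M"
    using schwartz_bounded[OF f] by blast
  then obtain A where A: "\<And>x. (A has_real_derivative A x - f x) (at x)" "bounded (range A)"
    using bounded_growth_ode_solution[of f M] schwartz_isCont[OF f] by auto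
  obtain B where B: "\<And>x. \<bar>A x\<bar> \<le> B" using A(2) by (auto simp: bounded_iff)
  text \<open>\<open>x\<^sup>k A\<close> solves the same equation with source \<open>x\<^sup>k f - k x\<^sup>k\<^sup>-\<^sup>1 A\<close>.\<close>
  have "\<exists>N. \<forall>x. \<bar>x ^ k * A x\<bar> \<le> N" for k
  proof (induction k)
    case 0
    then show ?case using B by auto
  next
    case (Suc k)
    then obtain N where N: "\<And>x. \<bar>x ^ k * A x\<bar> \<le> N" by blast
    obtain M where M: "\<And>x. \<bar>x ^ Suc k * f x\<bar> \<le> M"
      using schwartz_bounded[OF f] by blast
    have "\<bar>x ^ Suc k * A x\<bar> \<le> M + real (Suc k) * N" for x
    proof (rule growth_ode_bound[of "\<lambda>x. x ^ Suc k * A x"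
          "\<lambda>x. x ^ Suc k * f x - real (Suc k) * (x ^ k * A x)"])
      show "((\<lambda>x. x ^ Suc k * A x) has_real_derivative
          x ^ Suc k * A x - (x ^ Suc k * f x - real (Suc k) * (x ^ k * A x))) (at x)" for x
        by (rule derivative_eq_intros A refl)+ (simp add: algebra_simps)
      show "\<bar>x ^ Suc k * f x - real (Suc k) * (x ^ k * A x)\<bar> \<le> M + real (Suc k) * N" for x
      proof -
        have "\<bar>real (Suc k) * (x ^ k * A x)\<bar> \<le> real (Suc k) * N"
          using mult_left_mono[OF N[of x], of "real (Suc k)"] by (simp only: abs_mult abs_of_nat of_nat_0_le_iff)
        then show ?thesis using M[of x] by linarith
      qed
      \<comment> \<open>Boundedness of \<open>A\<close> already gives the growth condition, because
        powers of \<open>x\<close> are negligible against \<open>exp x\<close>. The bound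
        \<open>N\<close> of the previous moment enters through the source.\<close>
      have e: "((\<lambda>x. B * \<bar>x ^ Suc k / exp x\<bar>) \<longlongrightarrow> 0) at_top"
        using tendsto_mult_right_zero[OF tendsto_rabs_zero[OF tendsto_power_div_exp_0]] .
      show "((\<lambda>x. x ^ Suc k * A x * exp (- x)) \<longlongrightarrow> 0) at_top"
      proof (rule Lim_null_comparison[OF always_eventually e], intro allI)
        fix x
        have "\<bar>A x\<bar> * \<bar>x ^ Suc k / exp x\<bar> \<le> B * \<bar>x ^ Suc k / exp x\<bar>"
          by (intro mult_right_mono B) auto
        then show "norm (x ^ Suc k * A x * exp (- x)) \<le> B * \<bar>x ^ Suc k / exp x\<bar>"
          by (simp add: abs_mult exp_minus field_simps)
      qed
    qed
    then show ?case by blast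
  qed
  then have r: "rapid A" by (auto simp: rapid_def bounded_iff)
  \<comment> \<open>Bootstrapping: the derivative of \<open>A\<close> is \<open>A - f\<close>, so
    order \<open>n\<close> for \<open>A\<close> gives order \<open>n\<close> for its derivative,
    hence order \<open>Suc n\<close> for \<open>A\<close>.\<close>
  have "schwartz_upto n A" for n
  proof (induction n)
    case 0
    show ?case by (rule schwartz_uptoI[OF A(1) r]) simp
  next
    case (Suc n)
    have "schwartz_upto n (\<lambda>x. - 1 * f x)"
      using schwartz_upto_cmult[of n f "- 1"] f unfolding schwartz_iff_upto by blast
    from schwartz_upto_add[OF Suc this] show ?case
      by (intro schwartz_uptoI[OF A(1) r]) auto
  qed
  then show ?thesis using that A(1) by (auto simp: schwartz_iff_upto)
qed

lemma Helm_eq: "Helm f = (\<lambda>x. f x - D (D f) x)"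
  by (simp add: Helm_def numeral_2_eq_2)

lemma schwartz_Helm [schwartz_intros]: "schwartz f \<Longrightarrow> schwartz (Helm f)"
  unfolding Helm_eq by (intro schwartz_intros)

text \<open>The factorisation \<open>1 - \<partial>\<^sup>2 = (1 - \<partial>) (1 + \<partial>)\<close> reduces the existence of the inverse
  to two first-order equations, which are exchanged by the reflection \<open>x \<mapsto> - x\<close>.\<close>

lemma Helm_surj:
  assumes f: "schwartz f"
  obtains g where "schwartz g" "Helm g = f"
proof -
  obtain A where A: "schwartz A" "\<And>x. (A has_real_derivative A x - f x) (at x)"
    using schwartz_growth_ode[OF f] by blast
  obtain C where C: "schwartz C" "\<And>x. (C has_real_derivative C x - f (- x)) (at x)"
    using schwartz_growth_ode[OF schwartz_reflect[OF f]] by blast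
  define B where "B x = C (- x)" for x
  have B: "schwartz B" unfolding B_def by (rule schwartz_reflect[OF C(1)])
  have dB: "(B has_real_derivative f x - B x) (at x)" for x
    unfolding B_def using C(2)[of "- x"] by (simp add: DERIV_mirror)
  \<comment> \<open>Here \<open>(1 - D) A = f\<close> and \<open>(1 + D) B = f\<close>; the factor
    1/2 comes from the partial fractions
    \<open>1 / (1 - D^2) = (1/2) * (1 / (1 - D) + 1 / (1 + D))\<close>.\<close>
  define g where "g x = (1/2) * (A x + B x)" for x
  have g: "schwartz g" unfolding g_def by (intro schwartz_intros A B)
  define g' where "g' x = (1/2) * (A x - B x)" for x
  have "(g has_real_derivative g' x) (at x)" for x
    unfolding g_def g'_def by (auto intro!: derivative_eq_intros A(2) dB)
  then have g1: "deriv g = g'" by (auto intro: DERIV_imp_deriv)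
  have "(g' has_real_derivative g x - f x) (at x)" for x
    unfolding g_def g'_def by (auto intro!: derivative_eq_intros A(2) dB simp: field_simps)
  then have g2: "deriv g' = (\<lambda>x. g x - f x)"
    by (auto intro: DERIV_imp_deriv)
  show ?thesis using that[of g] g by (simp add: Helm_eq g1 g2)
qed

lemma Helm_inv_Helm: "schwartz f \<Longrightarrow> Helm_inv (Helm f) = f"
  by (intro formal_inverse_schwartz) auto

lemma deriv_perturb:
  assumes "schwartz f" "schwartz g"
  shows "deriv (\<lambda>x. f x + c * g x) = (\<lambda>x. deriv f x + c * deriv g x)"
  by (intro ext DERIV_imp_deriv DERIV_add DERIV_cmult schwartz_DERIV assms)

lemma Helm_add_cmult:
  assumes "schwartz f" "schwartz g"
  shows "Helm (\<lambda>x. f x + c * g x) = (\<lambda>x. Helm f x + c * Helm g x)"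
  using assms by (auto simp: Helm_eq deriv_perturb schwartz_deriv algebra_simps)


section \<open>Variational derivatives of quadratic functionals\<close>

lemma has_var_deriv_unique:
  assumes "has_var_deriv F f g" "has_var_deriv F f h"
  shows "g = h"
proof
  fix x
  have g: "schwartz g" and h: "schwartz h" using assms by (auto simp: has_var_deriv_def)
  \<comment> \<open>The difference of two candidates is itself Schwartz, hence an admissible
    direction; testing with it makes the integral of its square vanish.\<close>
  define \<phi> where "\<phi> x = g x - h x" for x
  have p: "schwartz \<phi>" unfolding \<phi>_def by (intro schwartz_intros g h)
  have "(LBINT x. g x * \<phi> x) = (LBINT x. h x * \<phi> x)"
    using assms p by (auto simp: has_var_deriv_def intro: DERIV_unique)
  moreover have "(LBINT x. g x * \<phi> x - h x * \<phi> x) = (LBINT x. g x * \<phi> x) - (LBINT x. h x * \<phi> x)"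
    by (intro Bochner_Integration.integral_diff schwartz_integrable schwartz_intros g h p)
  ultimately have "(LBINT x. \<phi> x * \<phi> x) = 0"
    by (simp add: \<phi>_def left_diff_distrib)
  from integral_square_zero[OF p this, of x] show "g x = h x" by (simp add: \<phi>_def)
qed

lemma var_deriv_eqI: "has_var_deriv F f g \<Longrightarrow> var_deriv F f = g"
  unfolding var_deriv_def using has_var_deriv_unique by blast

text \<open>\<open>K\<close> is the boundary term of the integration by parts.\<close>

lemma quadratic_functional_deriv:
  assumes S: "schwartz a" "schwartz b" "schwartz c" "schwartz K" "schwartz h"
    and F: "\<And>\<epsilon>. F \<epsilon> = (LBINT x. a x + \<epsilon> * b x + \<epsilon>\<^sup>2 * c x)"
    and K: "\<And>x. (K has_real_derivative b x - h x) (at x)"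
  shows "(F has_real_derivative (LBINT x. h x)) (at 0)"
proof -
  note I = S[THEN schwartz_integrable]
  have "(LBINT x. b x - h x) = 0"
    by (rule integral_schwartz_derivative[OF S(4) _ K]) (intro schwartz_intros S)
  then have b: "(LBINT x. b x) = (LBINT x. h x)"
    using I by (simp add: Bochner_Integration.integral_diff)
  have "F = (\<lambda>\<epsilon>. (LBINT x. a x) + \<epsilon> * (LBINT x. b x) + \<epsilon>\<^sup>2 * (LBINT x. c x))"
    using I by (auto simp: F)
  then show ?thesis
    unfolding b by (auto intro!: derivative_eq_intros)
qed


lemma Helm_inv_perturb:
  assumes "schwartz f" "schwartz g"
  shows "Helm_inv (\<lambda>x. Helm f x + c * Helm g x) = (\<lambda>x. f x + c * g x)"
  unfolding Helm_add_cmult[OF assms, symmetric]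
  by (intro Helm_inv_Helm schwartz_intros assms)

lemma deriv_Helm:
  assumes "schwartz f"
  shows "deriv (Helm f) = (\<lambda>x. D f x - D (D (D f)) x)"
  unfolding Helm_eq
  by (intro ext DERIV_imp_deriv DERIV_diff schwartz_DERIV schwartz_deriv assms)

section \<open>The gradient of \<open>H1\<close>\<close>

lemma H1_var_deriv_u: "has_var_deriv (\<lambda>f. H1 f v w) u (\<lambda>x. 0)"
  by (simp add: has_var_deriv_def H1_def schwartz_zero)

text \<open>This is the symmetry of \<open>1 - D^2\<close>:
  \<open>\<psi> * Helm r - r * Helm \<psi>\<close> is the derivative of the Wronskian
  \<open>r * D \<psi> - \<psi> * D r\<close>.\<close>

lemma H1_var_deriv_v:
  assumes p: "schwartz p" and r: "schwartz r"
  shows "has_var_deriv (\<lambda>f. H1 u f (Helm r)) (Helm p) r"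
  unfolding has_var_deriv_def
proof (intro conjI allI impI r)
  fix \<phi> assume "schwartz \<phi>"
  then obtain \<psi> where \<psi>: "schwartz \<psi>" "Helm \<psi> = \<phi>" using Helm_surj by blast
  show "((\<lambda>\<epsilon>. H1 u (\<lambda>x. Helm p x + \<epsilon> * \<phi> x) (Helm r)) has_real_derivative
      (LBINT x. r x * \<phi> x)) (at 0)"
  proof (rule quadratic_functional_deriv[where a = "\<lambda>x. p x * Helm r x" and
        b = "\<lambda>x. \<psi> x * Helm r x" and c = "\<lambda>x. 0" and K = "\<lambda>x. r x * D \<psi> x - \<psi> x * D r x"])
    show "H1 u (\<lambda>x. Helm p x + \<epsilon> * \<phi> x) (Helm r) =
        (LBINT x. p x * Helm r x + \<epsilon> * (\<psi> x * Helm r x) + \<epsilon>\<^sup>2 * 0)" for \<epsilon>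
      by (simp add: H1_def Helm_inv_perturb p \<psi>(1) \<psi>(2)[symmetric] algebra_simps)
    note d = schwartz_DERIV[OF \<psi>(1)] schwartz_DERIV[OF schwartz_deriv[OF \<psi>(1)]]
      schwartz_DERIV[OF r] schwartz_DERIV[OF schwartz_deriv[OF r]]
    show "((\<lambda>x. r x * D \<psi> x - \<psi> x * D r x) has_real_derivative
        \<psi> x * Helm r x - r x * \<phi> x) (at x)" for x
      by (auto intro!: derivative_eq_intros d simp: \<psi>(2)[symmetric] Helm_eq algebra_simps)
  qed (use \<open>schwartz \<phi>\<close> in \<open>intro schwartz_intros p r \<psi>(1); assumption\<close>)+
qed

lemma H1_var_deriv_w:
  assumes p: "schwartz p" and w: "schwartz w"
  shows "has_var_deriv (\<lambda>f. H1 u (Helm p) f) w p"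
  unfolding has_var_deriv_def
proof (intro conjI allI impI p)
  fix \<phi> assume \<phi>: "schwartz \<phi>"
  show "((\<lambda>\<epsilon>. H1 u (Helm p) (\<lambda>x. w x + \<epsilon> * \<phi> x)) has_real_derivative
      (LBINT x. p x * \<phi> x)) (at 0)"
    by (rule quadratic_functional_deriv[where a = "\<lambda>x. p x * w x" and
        b = "\<lambda>x. p x * \<phi> x" and c = "\<lambda>x. 0" and K = "\<lambda>x. 0"])
      (auto intro!: schwartz_intros p w \<phi> simp: H1_def Helm_inv_Helm p algebra_simps)
qed

section \<open>The gradient of \<open>H2\<close>\<close>

lemma H2_var_deriv_u:
  assumes u: "schwartz u" and p: "schwartz p" and r: "schwartz r"
  shows "has_var_deriv (\<lambda>f. H2 f (Helm p) (Helm r)) u (\<lambda>x. - 2 * (u x * p x * r x))"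
  unfolding has_var_deriv_def
proof (intro conjI allI impI)
  show "schwartz (\<lambda>x. - 2 * (u x * p x * r x))" by (intro schwartz_intros u p r)
  fix \<phi> assume \<phi>: "schwartz \<phi>"
  define w where "w = Helm r"
  have w: "schwartz w" unfolding w_def by (intro schwartz_intros r)
  show "((\<lambda>\<epsilon>. H2 (\<lambda>x. u x + \<epsilon> * \<phi> x) (Helm p) (Helm r)) has_real_derivative
      (LBINT x. - 2 * (u x * p x * r x) * \<phi> x)) (at 0)"
  \<comment> \<open>No derivative of \<open>u\<close> occurs in \<open>H2\<close>, so the boundary
    term is zero.\<close>
  proof (rule quadratic_functional_deriv[where
        a = "\<lambda>x. - ((u x)\<^sup>2 * p x * r x + w x * p x * D p x * r x - w x * (p x)\<^sup>2 * D r x)" and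
        b = "\<lambda>x. - 2 * (u x * p x * r x) * \<phi> x" and
        c = "\<lambda>x. - ((\<phi> x)\<^sup>2 * p x * r x)" and K = "\<lambda>x. 0"])
    show "H2 (\<lambda>x. u x + \<epsilon> * \<phi> x) (Helm p) (Helm r) =
       (LBINT x. - ((u x)\<^sup>2 * p x * r x + w x * p x * D p x * r x - w x * (p x)\<^sup>2 * D r x)
         + \<epsilon> * (- 2 * (u x * p x * r x) * \<phi> x) + \<epsilon>\<^sup>2 * (- ((\<phi> x)\<^sup>2 * p x * r x)))" for \<epsilon>
      unfolding H2_def Let_def Helm_inv_Helm[OF p] Helm_inv_Helm[OF r]
        Bochner_Integration.integral_minus[symmetric] w_def
      by (intro Bochner_Integration.integral_cong refl) (simp add: algebra_simps power2_eq_square)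
  qed (auto intro!: schwartz_intros u p r w \<phi>)
qed

lemma H2_var_deriv_v:
  assumes u: "schwartz u" and p: "schwartz p" and r: "schwartz r"
    and q: "schwartz q" and w: "w = Helm r"
    and Hq: "Helm q = (\<lambda>x. D w x * p x * r x + 3 * (w x * p x * D r x) - (u x)\<^sup>2 * r x)"
  shows "has_var_deriv (\<lambda>f. H2 u f w) (Helm p) q"
  unfolding has_var_deriv_def
proof (intro conjI allI impI q)
  fix \<phi> assume \<phi>: "schwartz \<phi>"
  then obtain \<psi> where \<psi>: "schwartz \<psi>" "Helm \<psi> = \<phi>" using Helm_surj by blast
  have sw: "schwartz w" unfolding w by (intro schwartz_intros r)
  have q2: "D (D q) x = q x - (D w x * p x * r x + 3 * (w x * p x * D r x) - (u x)\<^sup>2 * r x)" for x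
    using fun_cong[OF Hq, of x] by (simp add: Helm_eq)
  have \<phi>_eq: "\<phi> x = \<psi> x - D (D \<psi>) x" for x
    using fun_cong[OF \<psi>(2), of x] by (simp add: Helm_eq)
  let ?a = "\<lambda>x. - ((u x)\<^sup>2 * p x * r x + w x * p x * D p x * r x - w x * (p x)\<^sup>2 * D r x)"
  let ?b = "\<lambda>x. - ((u x)\<^sup>2 * \<psi> x * r x + w x * \<psi> x * D p x * r x + w x * p x * D \<psi> x * r x
    - 2 * (w x * p x * \<psi> x * D r x))"
  let ?c = "\<lambda>x. - (w x * \<psi> x * D \<psi> x * r x - w x * (\<psi> x)\<^sup>2 * D r x)"
  \<comment> \<open>The Wronskian of \<open>q\<close> and \<open>\<psi>\<close> moves
    \<open>1 - D^2\<close> from \<open>\<psi>\<close> to \<open>q\<close>; the last term absorbs the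
    one summand of \<open>?b\<close> that contains \<open>D \<psi>\<close>.\<close>
  let ?K = "\<lambda>x. q x * D \<psi> x - \<psi> x * D q x - w x * p x * r x * \<psi> x"
  show "((\<lambda>\<epsilon>. H2 u (\<lambda>x. Helm p x + \<epsilon> * \<phi> x) w) has_real_derivative
      (LBINT x. q x * \<phi> x)) (at 0)"
  proof (rule quadratic_functional_deriv[where a = ?a and b = ?b and c = ?c and K = ?K])
    show "H2 u (\<lambda>x. Helm p x + \<epsilon> * \<phi> x) w =
        (LBINT x. ?a x + \<epsilon> * ?b x + \<epsilon>\<^sup>2 * ?c x)" for \<epsilon>
      unfolding H2_def Let_def \<psi>(2)[symmetric] Helm_inv_perturb[OF p \<psi>(1)]
        deriv_perturb[OF p \<psi>(1)] Helm_inv_Helm[OF r, folded w]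
        Bochner_Integration.integral_minus[symmetric]
      by (intro Bochner_Integration.integral_cong refl) (simp add: algebra_simps power2_eq_square)
    note d = schwartz_DERIV[OF \<psi>(1)] schwartz_DERIV[OF schwartz_deriv[OF \<psi>(1)]]
      schwartz_DERIV[OF q] schwartz_DERIV[OF schwartz_deriv[OF q]]
      schwartz_DERIV[OF p] schwartz_DERIV[OF r] schwartz_DERIV[OF sw]
    show "(?K has_real_derivative ?b x - q x * \<phi> x) (at x)" for x
      by (rule derivative_eq_intros d refl)+ (simp add: \<phi>_eq q2 algebra_simps)
  qed (intro schwartz_intros u p r q sw \<phi> \<psi>(1))+
qed

text \<open>In \<open>H2\<close> the function w occurs both directly and through r, so a direction
  enters as \<open>\<phi>\<close> and as \<open>\<rho>\<close>. With
  \<open>A = p * (D p * r - p * D r)\<close>, moving \<open>1 - D^2\<close> from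
  \<open>\<rho>\<close> to \<open>A\<close> produces third derivatives. They recombine by
  \<open>Helm A + 3 * w * p * D p + D w * p^2 = 3 * v * D p * r + D v * p * r\<close>, which is why
  \<open>Hq\<close> contains v and not w.\<close>

lemma H2_var_deriv_w:
  assumes u: "schwartz u" and p: "schwartz p" and r: "schwartz r"
    and q: "schwartz q" and v: "v = Helm p"
    and Hq: "Helm q = (\<lambda>x. - 3 * (v x * D p x * r x) - D v x * p x * r x - (u x)\<^sup>2 * p x)"
  shows "has_var_deriv (\<lambda>f. H2 u v f) (Helm r) q"
  unfolding has_var_deriv_def
proof (intro conjI allI impI q)
  fix \<phi> assume \<phi>: "schwartz \<phi>"
  then obtain \<rho> where \<rho>: "schwartz \<rho>" "Helm \<rho> = \<phi>" using Helm_surj by blast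
  define w where "w = Helm r"
  have sw: "schwartz w" unfolding w_def by (intro schwartz_intros r)
  have q2: "D (D q) x = q x + 3 * ((p x - D (D p) x) * D p x * r x)
      + (D p x - D (D (D p)) x) * p x * r x + (u x)\<^sup>2 * p x" for x
    using fun_cong[OF Hq, of x] unfolding v deriv_Helm[OF p] by (simp add: Helm_eq)
  have \<phi>_eq: "\<phi> x = \<rho> x - D (D \<rho>) x" for x
    using fun_cong[OF \<rho>(2), of x] by (simp add: Helm_eq)
  have w_eq: "w x = r x - D (D r) x" "D w x = D r x - D (D (D r)) x" for x
    by (simp_all add: w_def deriv_Helm[OF r]) (simp add: Helm_eq)
  let ?a = "\<lambda>x. - ((u x)\<^sup>2 * p x * r x + w x * p x * D p x * r x - w x * (p x)\<^sup>2 * D r x)"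
  let ?b = "\<lambda>x. - ((u x)\<^sup>2 * p x * \<rho> x + \<phi> x * p x * D p x * r x + w x * p x * D p x * \<rho> x
    - \<phi> x * (p x)\<^sup>2 * D r x - w x * (p x)\<^sup>2 * D \<rho> x)"
  let ?c = "\<lambda>x. - (\<phi> x * p x * D p x * \<rho> x - \<phi> x * (p x)\<^sup>2 * D \<rho> x)"
  text \<open>With \<open>A = p (p\<^sub>x r - p r\<^sub>x)\<close>, the boundary term is
    \<open>q \<rho>\<^sub>x - q\<^sub>x \<rho> + A \<rho>\<^sub>x - A\<^sub>x \<rho> + w p\<^sup>2 \<rho>\<close>.\<close>
  let ?K = "\<lambda>x. q x * D \<rho> x - \<rho> x * D q x + p x * (D p x * r x - p x * D r x) * D \<rho> x
    - (D p x * (D p x * r x - p x * D r x) + p x * (D (D p) x * r x - p x * D (D r) x)) * \<rho> x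
    + w x * (p x)\<^sup>2 * \<rho> x"
  show "((\<lambda>\<epsilon>. H2 u v (\<lambda>x. Helm r x + \<epsilon> * \<phi> x)) has_real_derivative
      (LBINT x. q x * \<phi> x)) (at 0)"
  proof (rule quadratic_functional_deriv[where a = ?a and b = ?b and c = ?c and K = ?K])
    show "H2 u v (\<lambda>x. Helm r x + \<epsilon> * \<phi> x) =
        (LBINT x. ?a x + \<epsilon> * ?b x + \<epsilon>\<^sup>2 * ?c x)" for \<epsilon>
      unfolding H2_def Let_def \<rho>(2)[symmetric] Helm_inv_perturb[OF r \<rho>(1)]
        deriv_perturb[OF r \<rho>(1)] Helm_inv_Helm[OF p, folded v]
        Bochner_Integration.integral_minus[symmetric] w_def
      by (intro Bochner_Integration.integral_cong refl) (simp add: algebra_simps power2_eq_square)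
    note d = schwartz_DERIV[OF \<rho>(1)] schwartz_DERIV[OF schwartz_deriv[OF \<rho>(1)]]
      schwartz_DERIV[OF q] schwartz_DERIV[OF schwartz_deriv[OF q]]
      schwartz_DERIV[OF p] schwartz_DERIV[OF schwartz_deriv[OF p]]
      schwartz_DERIV[OF schwartz_deriv[OF schwartz_deriv[OF p]]]
      schwartz_DERIV[OF r] schwartz_DERIV[OF schwartz_deriv[OF r]]
      schwartz_DERIV[OF schwartz_deriv[OF schwartz_deriv[OF r]]]
      schwartz_DERIV[OF sw]
    show "(?K has_real_derivative ?b x - q x * \<phi> x) (at x)" for x
      by (rule derivative_eq_intros d refl)+
        (simp add: \<phi>_eq q2 w_eq algebra_simps power2_eq_square)
  qed (intro schwartz_intros u p r q sw \<phi> \<rho>(1))+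
qed


section \<open>The two Hamiltonian forms\<close>

definition novikov_rhs :: "fn \<Rightarrow> fn \<Rightarrow> fn \<Rightarrow> fn \<times> fn \<times> fn" where
  "novikov_rhs u p r = (let v = Helm p; w = Helm r in
     (\<lambda>x. - D (\<lambda>y. u y * p y * r y) x,
      \<lambda>x. - 3 * (v x * D p x * r x) - D v x * p x * r x - (u x)\<^sup>2 * p x,
      \<lambda>x. - 3 * (w x * p x * D r x) - D w x * p x * r x + (u x)\<^sup>2 * r x))"

lemma H2_gradient:
  assumes u: "schwartz u" and p: "schwartz p" and r: "schwartz r"
  shows "var_differentiable H2 (u, Helm p, Helm r)"
    and "opJ (u, Helm p, Helm r) (var_grad H2 (u, Helm p, Helm r)) = novikov_rhs u p r"
proof -
  define v w where "v = Helm p" and "w = Helm r"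
  have sv: "schwartz v" and sw: "schwartz w"
    unfolding v_def w_def by (intro schwartz_intros p r)+
  have "schwartz (\<lambda>x. D w x * p x * r x + 3 * (w x * p x * D r x) - (u x)\<^sup>2 * r x)"
    by (intro schwartz_intros u p r sw)
  then obtain q2 where q2: "schwartz q2"
    "Helm q2 = (\<lambda>x. D w x * p x * r x + 3 * (w x * p x * D r x) - (u x)\<^sup>2 * r x)"
    using Helm_surj by blast
  have "schwartz (\<lambda>x. - 3 * (v x * D p x * r x) - D v x * p x * r x - (u x)\<^sup>2 * p x)"
    by (intro schwartz_intros u p r sv)
  then obtain q3 where q3: "schwartz q3"
    "Helm q3 = (\<lambda>x. - 3 * (v x * D p x * r x) - D v x * p x * r x - (u x)\<^sup>2 * p x)"
    using Helm_surj by blast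
  note d1 = H2_var_deriv_u[OF u p r, folded v_def w_def]
  note d2 = H2_var_deriv_v[OF u p r q2(1) w_def q2(2), folded v_def]
  note d3 = H2_var_deriv_w[OF u p r q3(1) v_def q3(2), folded w_def]
  show "var_differentiable H2 (u, Helm p, Helm r)"
    using d1 d2 d3 by (auto simp: var_differentiable_def v_def w_def)
  have grad: "var_grad H2 (u, v, w) = (\<lambda>x. - 2 * (u x * p x * r x), q2, q3)"
    using d1 d2 d3 by (simp add: var_grad_def var_deriv_eqI)
  have "((\<lambda>x. - 2 * (u x * p x * r x)) has_real_derivative
      - 2 * D (\<lambda>y. u y * p y * r y) x) (at x)" for x
    by (intro DERIV_cmult schwartz_DERIV schwartz_intros u p r)
  then have "D (\<lambda>x. - 2 * (u x * p x * r x)) = (\<lambda>x. - 2 * D (\<lambda>y. u y * p y * r y) x)"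
    by (intro ext DERIV_imp_deriv)
  moreover have "(D ^^ 2) q2 x - q2 x = - Helm q2 x" for x
    by (simp add: Helm_def)
  moreover have "q3 x - (D ^^ 2) q3 x = Helm q3 x" for x
    by (simp add: Helm_def)
  ultimately show "opJ (u, Helm p, Helm r) (var_grad H2 (u, Helm p, Helm r)) = novikov_rhs u p r"
    unfolding v_def[symmetric] w_def[symmetric] grad
    by (simp add: opJ_def novikov_rhs_def Let_def q2(2) q3(2) fun_eq_iff flip: v_def w_def)
qed

text \<open>Both antiderivatives vanish at minus infinity, and so does the Schwartz function
  \<open>h\<close>; this fixes the constant by which the difference could deviate from
  \<open>h\<close>.\<close>

lemma Dinv_diff:
  assumes f: "schwartz f" and g: "schwartz g" and h: "schwartz h"
    and eq: "\<And>x. (h has_real_derivative f x - g x) (at x)"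
  shows "Dinv f x - Dinv g x = h x"
proof -
  obtain F where F: "smooth F" "bounded (range F)" "(F \<longlongrightarrow> 0) at_bot" "deriv F = f"
    using antiderivative_zero_at_bot[OF f] .
  obtain G where G: "smooth G" "bounded (range G)" "(G \<longlongrightarrow> 0) at_bot" "deriv G = g"
    using antiderivative_zero_at_bot[OF g] .
  have "Dinv f = F" "Dinv g = G"
    using F G by (auto intro!: formal_inverse_eqI)
  moreover have "F x - G x - h x = 0"
  proof (rule const_null_at_bot[of "\<lambda>x. F x - G x - h x"])
    show "((\<lambda>x. F x - G x - h x) has_real_derivative 0) (at x)" for x
      using smooth_has_deriv[OF F(1), of 0 x] smooth_has_deriv[OF G(1), of 0 x] F(4) G(4)
      by (auto intro!: derivative_eq_intros eq)
    show "((\<lambda>x. F x - G x - h x) \<longlongrightarrow> 0) at_bot"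
      using tendsto_diff[OF tendsto_diff[OF F(3) G(3)] schwartz_at_bot[OF h]] by simp
  qed
  ultimately show ?thesis by simp
qed

text \<open>The undifferentiated parts of \<open>Helm p\<close> and \<open>Helm r\<close> contribute
  \<open>- 2 * D (p * r)\<close>. The second-derivative parts contribute, with weights 1, 3, 3, 1
  over 2, the Leibniz expansion of half the third derivative of \<open>p * r\<close>.\<close>

lemma Omega_adj_gradient:
  assumes p: "schwartz p" and r: "schwartz r"
  shows "Omega_adj (u, Helm p, Helm r) (\<lambda>x. 0, r, p) = Cub (\<lambda>x. (1/2) * (p x * r x))"
proof
  fix x
  note d = schwartz_DERIV[OF p] schwartz_DERIV[OF schwartz_deriv[OF p]]
    schwartz_DERIV[OF schwartz_deriv[OF schwartz_deriv[OF p]]]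
    schwartz_DERIV[OF r] schwartz_DERIV[OF schwartz_deriv[OF r]]
    schwartz_DERIV[OF schwartz_deriv[OF schwartz_deriv[OF r]]]
  have 1: "D (\<lambda>x. (1/2) * (p x * r x)) = (\<lambda>x. (1/2) * (D p x * r x + p x * D r x))"
    by (intro ext DERIV_imp_deriv) (auto intro!: derivative_eq_intros d)
  have 2: "D (\<lambda>x. (1/2) * (D p x * r x + p x * D r x)) =
      (\<lambda>x. (1/2) * (D (D p) x * r x + 2 * (D p x * D r x) + p x * D (D r) x))"
    by (intro ext DERIV_imp_deriv) (auto intro!: derivative_eq_intros d simp: field_simps)
  have 3: "D (\<lambda>x. (1/2) * (D (D p) x * r x + 2 * (D p x * D r x) + p x * D (D r) x)) =
      (\<lambda>x. (1/2) * (D (D (D p)) x * r x + 3 * (D (D p) x * D r x) + 3 * (D p x * D (D r) x)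
        + p x * D (D (D r)) x))"
    by (intro ext DERIV_imp_deriv) (auto intro!: derivative_eq_intros d simp: field_simps)
  have 4: "D (\<lambda>y. (f y - D (D f) y) * g y) x =
      (D f x - D (D (D f)) x) * g x + (f x - D (D f) x) * D g x"
    if "schwartz f" "schwartz g" for f g
    by (intro DERIV_imp_deriv)
      (auto intro!: derivative_eq_intros schwartz_DERIV schwartz_intros that)
  show "Omega_adj (u, Helm p, Helm r) (\<lambda>x. 0, r, p) x = Cub (\<lambda>x. (1/2) * (p x * r x)) x"
    by (simp only: Omega_adj_def Cub_def prod.case Helm_eq numeral_3_eq_3 funpow.simps o_apply
        id_apply 1 2 3 4[OF p r] 4[OF r p] deriv_const) (simp add: field_simps)
qed

lemma H1_gradient:
  assumes u: "schwartz u" and p: "schwartz p" and r: "schwartz r"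
  shows "var_differentiable H1 (u, Helm p, Helm r)"
    and "opK (u, Helm p, Helm r) (var_grad H1 (u, Helm p, Helm r)) = novikov_rhs u p r"
proof -
  define v w where "v = Helm p" and "w = Helm r"
  have sv: "schwartz v" and sw: "schwartz w"
    unfolding v_def w_def by (intro schwartz_intros p r)+
  note d1 = H1_var_deriv_u[of v w u]
  note d2 = H1_var_deriv_v[OF p r, of u, folded v_def w_def]
  note d3 = H1_var_deriv_w[OF p sw, of u, folded v_def]
  show "var_differentiable H1 (u, Helm p, Helm r)"
    using d1 d2 d3 by (auto simp: var_differentiable_def v_def w_def)
  have grad: "var_grad H1 (u, v, w) = (\<lambda>x. 0, r, p)"
    using d1 d2 d3 by (simp add: var_grad_def var_deriv_eqI)
  define s where "s x = (1/2) * (p x * r x)" for x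
  have s: "schwartz s" unfolding s_def by (intro schwartz_intros p r)
  have "Omega_adj (u, v, w) (\<lambda>x. 0, r, p) = Cub s"
    using Omega_adj_gradient[OF p r, of u] by (simp add: v_def w_def s_def[abs_def])
  then have cub: "Cub_inv (Omega_adj (u, v, w) (\<lambda>x. 0, r, p)) = s"
    using formal_inverse_schwartz[OF s, of Cub] by simp
  note d = schwartz_DERIV[OF p] schwartz_DERIV[OF r] schwartz_DERIV[OF sv] schwartz_DERIV[OF sw]
    schwartz_DERIV[OF schwartz_deriv[OF p]] schwartz_DERIV[OF schwartz_deriv[OF r]]
  have dinv: "Dinv (\<lambda>y. v y * r y) x - Dinv (\<lambda>y. w y * p y) x = p x * D r x - D p x * r x" for x
  proof (rule Dinv_diff)
    show "((\<lambda>x. p x * D r x - D p x * r x) has_real_derivative v x * r x - w x * p x) (at x)" for x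
      by (rule derivative_eq_intros d refl)+ (simp add: v_def w_def Helm_eq algebra_simps)
  qed (intro schwartz_intros p r sv sw)+
  have ds: "D s x = (1/2) * (D p x * r x + p x * D r x)" for x
    unfolding s_def by (intro DERIV_imp_deriv) (auto intro!: derivative_eq_intros d)
  have dsm: "D (\<lambda>y. f y * s y) x = D f x * s x + f x * D s x" if "schwartz f" for f x
    by (intro DERIV_imp_deriv) (auto intro!: derivative_eq_intros schwartz_DERIV s that)
  \<comment> \<open>The first row of K has only the nonlocal part; its prefactor -2 cancels this 1/2
    and leaves \<open>- D (u * p * r)\<close>.\<close>
  have us: "D (\<lambda>y. u y * s y) x = (1/2) * D (\<lambda>y. u y * p y * r y) x" for x
  proof -
    have "((\<lambda>y. (1/2) * (u y * p y * r y)) has_real_derivative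
        (1/2) * D (\<lambda>y. u y * p y * r y) x) (at x)"
      by (intro DERIV_cmult schwartz_DERIV schwartz_intros u p r)
    then show ?thesis by (intro DERIV_imp_deriv) (simp add: s_def mult_ac)
  qed
  \<comment> \<open>The antiderivatives give \<open>(3/2) * v * (p * D r - D p * r)\<close> and the
    nonlocal part gives \<open>- 3 * v * D s = - (3/2) * v * (D p * r + p * D r)\<close>. The
    \<open>p * D r\<close> terms cancel and the others add up to \<open>- 3 * v * D p * r\<close>.
    In \<open>e3\<close> the sign of the first contribution is reversed, so \<open>p * D r\<close>
    survives.\<close>
  have e2: "(3/2) * (v x * Dinv (\<lambda>y. v y * r y) x)
      + (- ((u x)\<^sup>2 * p x) - (3/2) * (v x * Dinv (\<lambda>y. w y * p y) x))
      - 2 * ((1/2) * (v x * D s x) + D (\<lambda>y. v y * s y) x)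
      = - 3 * (v x * D p x * r x) - D v x * p x * r x - (u x)\<^sup>2 * p x" for x
  proof -
    have "Dinv (\<lambda>y. v y * r y) x = Dinv (\<lambda>y. w y * p y) x + (p x * D r x - D p x * r x)"
      using dinv[of x] by linarith
    then show ?thesis
      unfolding dsm[OF sv] ds by (simp only:) (simp add: s_def field_simps)
  qed
  have e3: "((u x)\<^sup>2 * r x - (3/2) * (w x * Dinv (\<lambda>y. v y * r y) x))
      + (3/2) * (w x * Dinv (\<lambda>y. w y * p y) x)
      - 2 * ((1/2) * (w x * D s x) + D (\<lambda>y. w y * s y) x)
      = - 3 * (w x * p x * D r x) - D w x * p x * r x + (u x)\<^sup>2 * r x" for x
  proof -
    have "Dinv (\<lambda>y. v y * r y) x = Dinv (\<lambda>y. w y * p y) x + (p x * D r x - D p x * r x)"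
      using dinv[of x] by linarith
    then show ?thesis
      unfolding dsm[OF sw] ds by (simp only:) (simp add: s_def field_simps)
  qed
  show "opK (u, Helm p, Helm r) (var_grad H1 (u, Helm p, Helm r)) = novikov_rhs u p r"
    unfolding v_def[symmetric] w_def[symmetric] grad opK_def novikov_rhs_def prod.case cub
      Omega_def Let_def
    by (simp only: us e2 e3 v_def[symmetric] w_def[symmetric]) simp
qed

text \<open>Each equation is solved for its time derivative, so the existentially quantified
  functions can only be the components of \<open>novikov_rhs\<close>.\<close>

lemma novikov3_at_iff:
  "novikov3_at u p r t \<longleftrightarrow>
    (case novikov_rhs (u t) (p t) (r t) of (a, b, c) \<Rightarrow>
      has_time_deriv u a t \<and> has_time_deriv (\<lambda>s. Helm (p s)) b t \<and>
      has_time_deriv (\<lambda>s. Helm (r s)) c t)"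
    (is "?N \<longleftrightarrow> ?R")
proof
  assume ?N
  then obtain a b c where
    td: "has_time_deriv u a t" "has_time_deriv (\<lambda>s. Helm (p s)) b t"
      "has_time_deriv (\<lambda>s. Helm (r s)) c t" and
    eq: "\<And>x. a x + D (\<lambda>y. u t y * p t y * r t y) x = 0"
      "\<And>x. b x + 3 * Helm (p t) x * D (p t) x * r t x + D (Helm (p t)) x * p t x * r t x
        + (u t x)\<^sup>2 * p t x = 0"
      "\<And>x. c x + 3 * Helm (r t) x * p t x * D (r t) x + D (Helm (r t)) x * p t x * r t x
        - (u t x)\<^sup>2 * r t x = 0"
    unfolding novikov3_at_def Let_def by blast
  have "(a, b, c) = novikov_rhs (u t) (p t) (r t)"
    unfolding novikov_rhs_def Let_def prod.inject
  proof (intro conjI ext)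
    fix x
    show "a x = - D (\<lambda>y. u t y * p t y * r t y) x" using eq(1)[of x] by linarith
    show "b x = - 3 * (Helm (p t) x * D (p t) x * r t x) - D (Helm (p t)) x * p t x * r t x
        - (u t x)\<^sup>2 * p t x" using eq(2)[of x] by (simp add: mult.assoc)
    show "c x = - 3 * (Helm (r t) x * p t x * D (r t) x) - D (Helm (r t)) x * p t x * r t x
        + (u t x)\<^sup>2 * r t x" using eq(3)[of x] by (simp add: mult.assoc)
  qed
  then show ?R using td by (auto split: prod.splits)
next
  assume ?R
  then show ?N
    unfolding novikov3_at_def novikov_rhs_def Let_def prod.case
    by (elim conjE, intro exI conjI) (assumption | simp add: mult.assoc)+
qed

theorem theorem1:
  fixes u p r v w :: "real \<Rightarrow> real \<Rightarrow> real" and T :: "real set"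
  assumes "open T"
    and "\<And>t. t \<in> T \<Longrightarrow> schwartz (u t) \<and> schwartz (p t) \<and> schwartz (r t)"
    and "v = (\<lambda>t. Helm (p t))" and "w = (\<lambda>t. Helm (r t))"
  shows "\<forall>t\<in>T.
      var_differentiable H1 (u t, v t, w t) \<and>
      var_differentiable H2 (u t, v t, w t) \<and>
      opJ (u t, v t, w t) (var_grad H2 (u t, v t, w t)) =
        opK (u t, v t, w t) (var_grad H1 (u t, v t, w t)) \<and>
      (novikov3_at u p r t \<longleftrightarrow> hamiltonian_form_at opJ H2 u v w t) \<and>
      (novikov3_at u p r t \<longleftrightarrow> hamiltonian_form_at opK H1 u v w t)"
proof
  fix t assume "t \<in> T"
  then have S: "schwartz (u t)" "schwartz (p t)" "schwartz (r t)" using assms(2) by auto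
  note J = H2_gradient[OF S] and K = H1_gradient[OF S]
  show "var_differentiable H1 (u t, v t, w t) \<and>
      var_differentiable H2 (u t, v t, w t) \<and>
      opJ (u t, v t, w t) (var_grad H2 (u t, v t, w t)) =
        opK (u t, v t, w t) (var_grad H1 (u t, v t, w t)) \<and>
      (novikov3_at u p r t \<longleftrightarrow> hamiltonian_form_at opJ H2 u v w t) \<and>
      (novikov3_at u p r t \<longleftrightarrow> hamiltonian_form_at opK H1 u v w t)"
    unfolding assms(3,4) novikov3_at_iff hamiltonian_form_at_def J(2) K(2) Let_def
    using J(1) K(1) by simp
qed

end
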